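(* Let $d^*$ be a symmetric approximate design whose class proportions $\{\pi^*_\ell\}_{\ell\in\mathcal C}$ achieve $$\max_{\{\pi_\ell\}_{\ell\in\mathcal C}}\ \min_{\gamma\in\mathbb R^5}\ \sum_{\ell\in\mathcal C}\pi_\ell\,h_\ell(\gamma),$$ where the maximum is over all families $\{\pi_\ell\}_{\ell\in\mathcal C}$ with $\pi_\ell\ge 0$ and $\sum_{\ell\in\mathcal C}\pi_\ell=1$. Then $d^*$ is universally optimal for $\phi$ among all (approximate) designs with the same $n$, $k$, $t$.
   Context: Fix positive integers $n$ (subjects), $k$ (periods), $t$ (treatments, labelled $1,\ldots,t$). Let $\mathcal S=\{1,\ldots,t\}^k$ be the set of sequences of $k$ treatments. An (approximate) design $d$ is given by proportions $\pi_d(s)\ge 0$, $s\in\mathcal S$, with $\sum_{s}\pi_d(s)=1$ (an exact design with $n$ subjects corresponds to all $\pi_d(s)$ being multiples of $1/n$, where $\pi_d(s)$ is the proportion of subjects receiving $s$). The underlying model is $y_{ij}=\beta_i+\xi_{d(i,j),d(i,j-1)}+\varepsilon_{ij}$ with $d(i,0)=0$ (fictitious treatment $0$ before period 1), uncorrelated errors of common variance. Index the coordinates of $\mathbb R^{t(t+1)}$ by pairs $uv$ with $u\in\{1,\ldots,t\}$, $v\in\{0,1,\ldots,t\}$. For $s=(s_1,\ldots,s_k)\in\mathcal S$ put $s_0=0$ and let $X_s$ be the $k\times t(t+1)$ matrix whose $(j,uv)$ entry is $1$ if $s_j=u$ and $s_{j-1}=v$, and $0$ otherwise. Let $Q_m=I_m-m^{-1}J_m$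 where $J_m$ is the $m\times m$ all-ones matrix. Put $C_s[\xi]=X_s'Q_kX_s$ and $$C_d[\xi]=n\sum_{s\in\mathcal S}\pi_d(s)\,C_s[\xi].$$ Let $K$ be the $t(t+1)\times t$ matrix with entries $K_{uv}^w=1$ if $u=v=w$ and $0$ otherwise ($uv$ row index, $w$ column index), so that $\phi=K'\xi$ is the vector of total effects $\phi_u=\xi_{uu}$. The information matrix for $\phi$ is $$C_d[\phi]=\min\{L'C_d[\xi]L : L\in\mathbb R^{t(t+1)\times t},\ L'K=I_t\},$$ the minimum being with respect to the Loewner ordering (it exists and is unique). For a permutation $\sigma$ of $\{1,\ldots,t\}$, $s_\sigma$ denotes the sequence obtained from $s$ by applying $\sigma$ to each treatment label. A design $d$ is symmetric if $\pi_d(s_\sigma)=\pi_d(s)$ for all $s\in\mathcal S$ and all permutations $\sigma$. Two sequences are equivalent if one is obtained from the other by a permutation of treatment labels; $\mathcal C$ is the set of equivalence classes. For a symmetric design $d$ and $\ell\in\mathcal C$, the class proportion is $\pi_\ell=\sum_{s\in\ell}\pi_d(s)$. Define the following subsets of $\{1,\ldots,t\}\times\{0,\ldots,t\}\times\{1,\ldots,t\}$ (with $u,v,w\in\{1,\ldots,t\}$): $\mathcal O_1=\{(u,u,u)\}$; $\mathcal O_2=\{(u,v,u): u\ne v\}$; $\mathcal O_3=\{(u,v,v):u\neq v\}$; $\mathcal O_4=\{(u,v,w): u,v,w \text{ pairwise distinct}\}$; $\mathcal O_5=\{(u,0,u)\}$; $\mathcal O_6=\{(u,0,w):u\ne w\}$.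 For $q=1,\ldots,6$ let $L_{(q)}$ be the $t(t+1)\times t$ matrix whose entry in row $uv$ and column $w$ is $1$ if $(u,v,w)\in\mathcal O_q$ and $0$ otherwise. For a sequence $s$ put $c_{spq}=\operatorname{tr}(L_{(p)}'C_s[\xi]L_{(q)})$; this depends only on the class $\ell$ of $s$ and is written $c_{\ell pq}$. For $\gamma=(\gamma_2,\ldots,\gamma_6)\in\mathbb R^5$ put $$h_\ell(\gamma)=\sum_{p=1}^6\sum_{q=1}^6\gamma_p\gamma_q c_{\ell pq},\qquad \gamma_1=1.$$ Universal optimality (Kiefer): $d^*$ is universally optimal for $\phi$ in a class of designs if $\Phi(C_{d^*}[\phi])\le\Phi(C_d[\phi])$ for every $d$ in the class and every function $\Phi$ from the set of $t\times t$ symmetric nonnegative definite matrices with zero row and column sums to $(-\infty,+\infty]$ that is convex, is invariant under simultaneous permutation of rows and columns, and is such that $b\mapsto\Phi(bC)$ is nonincreasing on $b\ge 0$ for each $C$. *)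

theory Defs
  imports "HOL-Analysis.Analysis"
begin

text \<open>
  The treatments are the elements of a finite type \<open>'t\<close> (so \<open>t = CARD('t)\<close>), the periods
  those of a finite linearly ordered type \<open>'k\<close> (so \<open>k = CARD('k)\<close>); both are arbitrary
  and nonempty.  A sequence of \<open>k\<close> treatments is a function \<open>'k \<Rightarrow> 't\<close>.
  The labels \<open>{0, 1, \<dots>, t}\<close> of a preceding treatment are rendered by \<open>'t option\<close>, with
  \<open>None\<close> for the fictitious treatment 0, so the coordinates \<open>uv\<close> of the parameter
  \<open>\<xi>\<close> are indexed by \<open>'t \<times> 't option\<close>.
  A matrix with rows indexed by \<open>'m\<close> and columns indexed by \<open>'n\<close> has type \<open>real^'n^'m\<close>.
\<close>

definition prev_treatment :: "('k::{finite,linorder} \<Rightarrow> 't) \<Rightarrow> 'k \<Rightarrow> 't option" where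
  "prev_treatment s j = (if \<exists>i. i < j then Some (s (Max {i. i < j})) else None)"

definition X_mat :: "('k::{finite,linorder} \<Rightarrow> 't::finite)
  \<Rightarrow> real^('t \<times> 't option)^('k::{finite,linorder})"
where
  "X_mat s = (\<chi> j uv. if s j = fst uv \<and> prev_treatment s j = snd uv then 1 else 0)"

definition Q_mat :: "real^'m^'m" where
  "Q_mat = mat 1 - (1 / real CARD('m)) *\<^sub>R (\<chi> i j. 1)"

definition C_seq ::
  "('k::{finite,linorder} \<Rightarrow> 't::finite) \<Rightarrow> real^('t \<times> 't option)^('t \<times> 't option)" where
  "C_seq s = transpose (X_mat s) ** Q_mat ** X_mat s"

definition design :: "(('k::finite \<Rightarrow> 't::finite) \<Rightarrow> real) \<Rightarrow> bool" where
  "design d \<longleftrightarrow> (\<forall>s. 0 \<le> d s) \<and> (\<Sum>s\<in>UNIV. d s) = 1"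

definition C_xi ::
  "nat \<Rightarrow> (('k::{finite,linorder} \<Rightarrow> 't::finite) \<Rightarrow> real) \<Rightarrow> real^('t \<times> 't option)^('t \<times> 't option)"
where
  "C_xi n d = real n *\<^sub>R (\<Sum>s\<in>UNIV. d s *\<^sub>R C_seq s)"

definition K_mat :: "real^'t^('t::finite \<times> 't option)" where
  "K_mat = (\<chi> uv w. if fst uv = w \<and> snd uv = Some w then 1 else 0)"

definition nonneg_definite :: "real^'m^'m \<Rightarrow> bool" where
  "nonneg_definite M \<longleftrightarrow> transpose M = M \<and> (\<forall>x. 0 \<le> x \<bullet> (M *v x))"

definition loewner_le :: "real^'m^'m \<Rightarrow> real^'m^'m \<Rightarrow> bool" where
  "loewner_le A B \<longleftrightarrow> nonneg_definite (B - A)"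

definition loewner_Min :: "(real^'m^'m) set \<Rightarrow> real^'m^'m" where
  "loewner_Min S = (THE M. M \<in> S \<and> (\<forall>N\<in>S. loewner_le M N))"

definition C_phi :: "nat \<Rightarrow> (('k::{finite,linorder} \<Rightarrow> 't::finite) \<Rightarrow> real) \<Rightarrow> real^'t^'t" where
  "C_phi n d = loewner_Min
     {transpose L ** C_xi n d ** L | L :: real^'t^('t \<times> 't option). transpose L ** K_mat = mat 1}"

definition symmetric_design :: "(('k::finite \<Rightarrow> 't::finite) \<Rightarrow> real) \<Rightarrow> bool" where
  "symmetric_design d \<longleftrightarrow> design d \<and> (\<forall>s \<sigma>. bij \<sigma> \<longrightarrow> d (\<sigma> \<circ> s) = d s)"

definition seq_equiv :: "(('k \<Rightarrow> 't) \<times> ('k \<Rightarrow> 't)) set" where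
  "seq_equiv = {(s, s'). \<exists>\<sigma>. bij \<sigma> \<and> s' = \<sigma> \<circ> s}"

definition seq_classes :: "('k \<Rightarrow> 't) set set" where
  "seq_classes = UNIV // seq_equiv"

definition class_proportion :: "(('k \<Rightarrow> 't) \<Rightarrow> real) \<Rightarrow> ('k \<Rightarrow> 't) set \<Rightarrow> real" where
  "class_proportion d l = (\<Sum>s\<in>l. d s)"

definition orbit :: "nat \<Rightarrow> ('t \<times> 't option \<times> 't) set" where
  "orbit q =
    (if q = 1 then {(u, Some u, u) | u. True}
     else if q = 2 then {(u, Some v, u) | u v. u \<noteq> v}
     else if q = 3 then {(u, Some v, v) | u v. u \<noteq> v}
     else if q = 4 then {(u, Some v, w) | u v w. u \<noteq> v \<and> v \<noteq> w \<and> u \<noteq> w}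
     else if q = 5 then {(u, None, u) | u. True}
     else if q = 6 then {(u, None, w) | u w. u \<noteq> w}
     else {})"

definition L_mat :: "nat \<Rightarrow> real^'t^('t::finite \<times> 't option)" where
  "L_mat q = (\<chi> uv w. if (fst uv, snd uv, w) \<in> orbit q then 1 else 0)"

definition c_seq :: "('k::{finite,linorder} \<Rightarrow> 't::finite) \<Rightarrow> nat \<Rightarrow> nat \<Rightarrow> real" where
  "c_seq s p q = trace (transpose (L_mat p) ** C_seq s ** L_mat q)"

text \<open>The value \<open>c_seq s p q\<close> is the same for all \<open>s\<close> in an equivalence class \<open>l\<close>.\<close>

definition c_class :: "('k::{finite,linorder} \<Rightarrow> 't::finite) set \<Rightarrow> nat \<Rightarrow> nat \<Rightarrow> real" where
  "c_class l p q = the_elem ((\<lambda>s. c_seq s p q) ` l)"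

text \<open>
  A vector \<open>\<gamma> = (\<gamma>\<^sub>2, \<dots>, \<gamma>\<^sub>6)\<close> is a function on \<open>{2..6}\<close>, i.e. an element of
  \<open>{2..6} \<rightarrow>\<^sub>E UNIV\<close>; the update sets \<open>\<gamma>\<^sub>1 = 1\<close>.
\<close>

definition h_class :: "('k::{finite,linorder} \<Rightarrow> 't::finite) set \<Rightarrow> (nat \<Rightarrow> real) \<Rightarrow> real" where
  "h_class l \<gamma> =
    (\<Sum>p=1..6. \<Sum>q=1..6. (\<gamma>(1 := 1)) p * (\<gamma>(1 := 1)) q * c_class l p q)"

definition class_weights :: "(('k \<Rightarrow> 't) set \<Rightarrow> real) \<Rightarrow> bool" where
  "class_weights \<pi> \<longleftrightarrow>
    (\<forall>l\<in>seq_classes. 0 \<le> \<pi> l) \<and> (\<Sum>l\<in>seq_classes. \<pi> l) = 1"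

text \<open>
  The minimum below is attained, since the objective is a quadratic polynomial in \<open>\<gamma>\<close>
  that is bounded below by 0 for nonnegative weights.
\<close>

definition min_h :: "(('k::{finite,linorder} \<Rightarrow> 't::finite) set \<Rightarrow> real) \<Rightarrow> real" where
  "min_h \<pi> = (LEAST m. m \<in> (\<lambda>\<gamma>. \<Sum>l\<in>seq_classes. \<pi> l * h_class l \<gamma>) ` ({2..6} \<rightarrow>\<^sub>E UNIV))"

definition maximin_weights :: "(('k::{finite,linorder} \<Rightarrow> 't::finite) set \<Rightarrow> real) \<Rightarrow> bool" where
  "maximin_weights \<pi> \<longleftrightarrow>
    class_weights \<pi> \<and> (\<forall>\<pi>' :: ('k \<Rightarrow> 't) set \<Rightarrow> real. class_weights \<pi>' \<longrightarrow> min_h \<pi>' \<le> min_h \<pi>)"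

definition info_matrices :: "(real^'t^'t) set" where
  "info_matrices = {C. nonneg_definite C \<and>
     (\<forall>i. (\<Sum>j\<in>UNIV. C $ i $ j) = 0) \<and> (\<forall>j. (\<Sum>i\<in>UNIV. C $ i $ j) = 0)}"

text \<open>
  Only the values of \<open>\<Phi>\<close> on \<open>info_matrices\<close> are constrained; excluding \<open>-\<infinity>\<close> there makes
  the right-hand side of the convexity inequality well defined.
\<close>

definition kiefer_criterion :: "(real^'t^'t \<Rightarrow> ereal) \<Rightarrow> bool" where
  "kiefer_criterion \<Phi> \<longleftrightarrow>
    (\<forall>C\<in>info_matrices. \<Phi> C \<noteq> -\<infinity>) \<and>
    (\<forall>A\<in>info_matrices. \<forall>B\<in>info_matrices. \<forall>a b. 0 \<le> a \<and> 0 \<le> b \<and> a + b = 1 \<longrightarrow>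
       \<Phi> (a *\<^sub>R A + b *\<^sub>R B) \<le> ereal a * \<Phi> A + ereal b * \<Phi> B) \<and>
    (\<forall>C\<in>info_matrices. \<forall>\<sigma>. bij \<sigma> \<longrightarrow> \<Phi> (\<chi> i j. C $ \<sigma> i $ \<sigma> j) = \<Phi> C) \<and>
    (\<forall>C\<in>info_matrices. \<forall>a b. 0 \<le> a \<and> a \<le> b \<longrightarrow> \<Phi> (b *\<^sub>R C) \<le> \<Phi> (a *\<^sub>R C))"

definition universally_optimal ::
  "nat \<Rightarrow> (('k::{finite,linorder} \<Rightarrow> 't::finite) \<Rightarrow> real) set \<Rightarrow> (('k \<Rightarrow> 't) \<Rightarrow> real) \<Rightarrow> bool" where
  "universally_optimal n D d' \<longleftrightarrow>
    (\<forall>\<Phi>. kiefer_criterion \<Phi> \<longrightarrow> (\<forall>d\<in>D. \<Phi> (C_phi n d') \<le> \<Phi> (C_phi n d)))"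

end

theory Submission imports Defs begin

text \<open>
  Everything rests on the trace of \<open>C_phi n d\<close>, which for every design is at most
  \<open>n\<close> times the inner minimum of the maximin problem at the class proportions of \<open>d\<close>, with
  equality when \<open>d\<close> is symmetric.

  \<^item> Upper bound (\<open>trace_C_phi_le\<close>).  A combination \<open>L = L_mat 1 + \<gamma> 2 L_mat 2 + \<dots>\<close>
    satisfies \<open>L' K = I\<close>, so the Loewner minimum lies below \<open>L' C L\<close>.  The trace of the latter is
    \<open>n\<close> times the average of the functions \<open>h_class l \<gamma>\<close> under the class proportions.

  \<^item> Lower bound (\<open>trace_C_phi_ge\<close>).  For a symmetric design, averaging a minimising \<open>L\<close> over
    all relabellings of the treatments does not increase \<open>trace (L' C L)\<close>, a squared Euclidean
    norm of a linear image of \<open>L\<close> that relabelling preserves.  The average is invariant, hence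
    constant on the orbits of the symmetric group on the index triples, hence one of the
    combinations above (\<open>invariant_imp_L_comb\<close>).

  So the maximin design has the largest trace among all designs.  This suffices
  for universal optimality.  Given a competitor \<open>d\<close>, let \<open>A\<close> be the average of \<open>C_phi n d\<close> over
  all simultaneous permutations of rows and columns; convexity and invariance of a criterion give
  \<open>\<Phi> A \<le> \<Phi> (C_phi n d)\<close>.  Both \<open>A\<close> and \<open>C_phi n d'\<close> are permutation-invariant with zero row
  sums, hence multiples of \<open>Q_mat\<close> determined by their traces (\<open>invariant_zero_sum_matrix\<close>), and
  the monotonicity of \<open>b \<mapsto> \<Phi> (b Q)\<close> compares them.

  Minimisation problems, both for the Loewner minimum and for the minimum over \<open>\<gamma>\<close>, are least
  squares problems on an affine subspace, solved by orthogonal projection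
  (\<open>least_squares_exists\<close>).
\<close>

section \<open>Matrices as Euclidean vectors\<close>

lemma linear_matrix_mult_right: "linear (\<lambda>B :: real^'n^'m. A ** B)"
  by (rule linearI)
     (simp_all add: vec_eq_iff matrix_matrix_mult_def distrib_left sum.distrib sum_distrib_left
       mult.left_commute)

lemma linear_matrix_mult_left: "linear (\<lambda>A :: real^'n^'m. A ** B)"
  by (rule linearI)
     (simp_all add: vec_eq_iff matrix_matrix_mult_def distrib_right sum.distrib sum_distrib_left
       mult.assoc)

lemma linear_transpose: "linear (transpose :: real^'n^'m \<Rightarrow> real^'m^'n)"
  by (rule linearI) (simp_all add: vec_eq_iff transpose_def)

lemma linear_trace: "linear (trace :: real^'n^'n \<Rightarrow> real)"
  by (rule linearI) (simp_all add: trace_def sum.distrib sum_distrib_left)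

lemma trace_transpose_mult: "trace (transpose A ** B) = A \<bullet> (B :: real^'n^'m)"
  unfolding trace_def matrix_matrix_mult_def transpose_def inner_vec_def
  by (simp, rule sum.swap)

lemma inner_gram: "x \<bullet> ((transpose A ** A) *v x) = (norm (A *v (x :: real^'n)))\<^sup>2"
  by (metis matrix_vector_mul_assoc inner_commute dot_lmul_matrix transpose_matrix_vector
      power2_norm_eq_inner)

text \<open>
  Testing against \<open>F = (A' B)'\<close> turns the trace into the squared Frobenius norm of \<open>A' B\<close>.  This
  passes from the scalar optimality condition of a trace minimiser to the matrix equation behind
  Loewner minimality.
\<close>

lemma transpose_mult_eq_0_if_orthogonal:
  fixes A B :: "real^'n^'m"
  assumes "\<And>F :: real^'n^'n. trace (transpose A ** (B ** F)) = 0"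
  shows "transpose A ** B = 0"
proof -
  let ?M = "transpose A ** B"
  have "?M \<bullet> ?M = trace (transpose ?M ** ?M)" by (simp add: trace_transpose_mult)
  also have "\<dots> = trace (transpose A ** (B ** transpose ?M))"
    by (metis trace_mul_sym matrix_mul_assoc)
  also have "\<dots> = 0" by (rule assms)
  finally show ?thesis by simp
qed

text \<open>
  Project \<open>G x\<close> onto the orthogonal complement of \<open>G ` S\<close>.
\<close>

lemma least_squares_exists:
  fixes G :: "'a::real_vector \<Rightarrow> 'b::euclidean_space"
  assumes "linear G" and "subspace S"
  obtains z where "z - x \<in> S" and "\<And>y. y \<in> S \<Longrightarrow> G z \<bullet> G y = 0"
proof -
  obtain p q where p: "p \<in> span (G ` S)" and q: "\<And>w. w \<in> span (G ` S) \<Longrightarrow> orthogonal q w"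
    and x: "G x = p + q"
    using orthogonal_subspace_decomp_exists[of "G ` S" "G x"] by metis
  have span: "span (G ` S) = G ` S"
    by (simp add: assms linear_subspace_image span_eq_iff)
  obtain r where r: "r \<in> S" "p = G r" using p unfolding span by auto
  have "G (x - r) = q" using x r by (simp add: linear_diff[OF assms(1)])
  moreover have "x - r - x \<in> S" using r assms(2) by (simp add: subspace_neg)
  ultimately show ?thesis using that[of "x - r"] q by (auto simp: span orthogonal_def)
qed

lemma norm_least_squares_le:
  fixes G :: "'a::real_vector \<Rightarrow> 'b::euclidean_space"
  assumes "linear G" and "\<And>y. y \<in> S \<Longrightarrow> G z \<bullet> G y = 0" and "z' - z \<in> S"
  shows "norm (G z) \<le> norm (G z')"
proof -
  have "G z' = G z + G (z' - z)" by (simp add: linear_diff[OF assms(1)])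
  then have "(norm (G z'))\<^sup>2 = (norm (G z))\<^sup>2 + (norm (G (z' - z)))\<^sup>2"
    using assms(2)[OF assms(3)]
    by (simp add: power2_norm_eq_inner inner_add_left inner_add_right inner_commute)
  then have "(norm (G z))\<^sup>2 \<le> (norm (G z'))\<^sup>2" by simp
  then show ?thesis by (rule power2_le_imp_le) simp
qed

section \<open>Nonnegative definite matrices and the Loewner order\<close>

lemma nonneg_definite_gram: "nonneg_definite (transpose A ** (A :: real^'n^'m))"
  unfolding nonneg_definite_def by (simp add: matrix_transpose_mul inner_gram)

lemma nonneg_definite_sum_scaleR:
  assumes "\<And>i. i \<in> I \<Longrightarrow> 0 \<le> a i" and "\<And>i. i \<in> I \<Longrightarrow> nonneg_definite (M i)"
  shows "nonneg_definite (\<Sum>i\<in>I. a i *\<^sub>R M i)"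
proof -
  have "transpose (\<Sum>i\<in>I. a i *\<^sub>R M i) = (\<Sum>i\<in>I. a i *\<^sub>R M i)"
    using assms(2) by (simp add: linear_sum[OF linear_transpose] transpose_scalar
        nonneg_definite_def)
  moreover have "x \<bullet> ((\<Sum>i\<in>I. a i *\<^sub>R M i) *v x) = (\<Sum>i\<in>I. a i * (x \<bullet> (M i *v x)))" for x
  proof -
    have "linear (\<lambda>M. M *v x)"
      by (rule linearI) (simp_all add: matrix_vector_mult_add_rdistrib scaleR_matrix_vector_assoc)
    from linear_sum[OF this, of "\<lambda>i. a i *\<^sub>R M i" I] show ?thesis
      by (simp add: inner_sum_right flip: scaleR_matrix_vector_assoc)
  qed
  ultimately show ?thesis
    using assms by (auto simp: nonneg_definite_def intro!: sum_nonneg)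
qed

lemma nonneg_definite_diag:
  assumes "nonneg_definite M"
  shows "0 \<le> M $ i $ i"
proof -
  have "0 \<le> axis i 1 \<bullet> (M *v axis i 1)" using assms by (simp add: nonneg_definite_def)
  then show ?thesis
    by (simp add: inner_axis' matrix_vector_mul_component inner_axis)
qed

lemma nonneg_definite_trace: "nonneg_definite M \<Longrightarrow> 0 \<le> trace M"
  by (simp add: trace_def nonneg_definite_diag sum_nonneg)

text \<open>
  A symmetric matrix is determined by its quadratic form (polarization); this is what makes the
  Loewner minimum unique.
\<close>

lemma nonneg_definite_antisym:
  assumes "nonneg_definite M" and "nonneg_definite (- M)"
  shows "M = 0"
proof -
  have sym: "transpose M = M" using assms(1) by (simp add: nonneg_definite_def)
  have q: "x \<bullet> (M *v x) = 0" for x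
  proof -
    have "0 \<le> x \<bullet> (M *v x)" using assms(1) by (simp add: nonneg_definite_def)
    moreover have "0 \<le> x \<bullet> (- M *v x)" using assms(2) by (simp add: nonneg_definite_def)
    moreover have "- M *v x = - (M *v x)"
      by (simp add: vec_eq_iff matrix_vector_mult_def sum_negf)
    ultimately show ?thesis by simp
  qed
  have "y \<bullet> (M *v x) = 0" for x y
  proof -
    have "x \<bullet> (M *v y) = y \<bullet> (M *v x)"
      by (metis sym dot_lmul_matrix inner_commute transpose_matrix_vector)
    then show ?thesis using q[of "x + y"] q[of x] q[of y]
      by (simp add: matrix_vector_right_distrib inner_add_left inner_add_right)
  qed
  then have "M *v x = 0" for x by (metis inner_eq_zero_iff)
  then show ?thesis by (simp add: matrix_eq)
qed

lemma loewner_Min_eqI: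
  assumes "M \<in> S" and "\<And>N. N \<in> S \<Longrightarrow> loewner_le M N"
  shows "loewner_Min S = M"
  unfolding loewner_Min_def
proof (rule the_equality)
  fix N assume N: "N \<in> S \<and> (\<forall>P\<in>S. loewner_le N P)"
  then have "loewner_le M N" "loewner_le N M" using assms by auto
  then have "M - N = 0" using nonneg_definite_antisym[of "M - N"] by (simp add: loewner_le_def)
  then show "N = M" by simp
qed (use assms in auto)

section \<open>The information matrix\<close>

lemma Q_mat_nth: "Q_mat $ i $ j = (if i = j then 1 else 0) - 1 / real CARD('m)"
  for i j :: "'m::finite"
  by (simp add: Q_mat_def mat_def)

lemma transpose_Q_mat: "transpose Q_mat = (Q_mat :: real^'m::finite^'m)"
  by (simp add: vec_eq_iff transpose_def Q_mat_nth)

lemma Q_mat_idem: "Q_mat ** Q_mat = (Q_mat :: real^'m::finite^'m)"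
proof -
  have "(\<Sum>k\<in>UNIV. Q_mat $ i $ k * Q_mat $ k $ j) = Q_mat $ i $ j" for i j :: 'm
  proof -
    have "(\<Sum>k\<in>UNIV. Q_mat $ i $ k * Q_mat $ k $ j) =
       (\<Sum>k\<in>UNIV. (if k = i then (if i = j then 1 else 0) else 0) - 
         (if k = i then 1 / real CARD('m) else 0) - (if k = j then 1 / real CARD('m) else 0)
         + 1 / real CARD('m) * (1 / real CARD('m)))"
      by (rule sum.cong) (auto simp: Q_mat_nth algebra_simps)
    also have "\<dots> = Q_mat $ i $ j"
      by (simp add: sum.distrib sum_subtractf Q_mat_nth)
    finally show ?thesis .
  qed
  then show ?thesis by (simp add: vec_eq_iff matrix_matrix_mult_def)
qed

lemma Q_mat_ones: "Q_mat *v 1 = (0 :: real^'m::finite)"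
  by (simp add: vec_eq_iff matrix_vector_mult_def Q_mat_nth sum_subtractf)

text \<open>
  Since \<open>Q_mat\<close> is a symmetric idempotent, \<open>L' C_s E\<close> is the Gram product of \<open>Q X_s L\<close> and
  \<open>Q X_s E\<close>.
\<close>
definition adjusted ::
  "('k::{finite,linorder} \<Rightarrow> 't::finite) \<Rightarrow> real^'n^('t \<times> 't option)
    \<Rightarrow> real^'n^('k::{finite,linorder})" where
  "adjusted s L = Q_mat ** (X_mat s ** L)"

lemma X_mat_mult_nth: "(X_mat s ** L) $ j $ w = L $ (s j, prev_treatment s j) $ w"
proof -
  have "(X_mat s ** L) $ j $ w =
      (\<Sum>uv\<in>UNIV. if uv = (s j, prev_treatment s j) then L $ uv $ w else 0)"
    unfolding matrix_matrix_mult_def X_mat_def vec_lambda_beta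
    by (rule sum.cong) (auto simp: prod_eq_iff)
  then show ?thesis by simp
qed

lemma linear_adjusted: "linear (adjusted s)"
  by (rule linearI)
     (simp_all add: adjusted_def linear_add[OF linear_matrix_mult_right]
        linear_scale[OF linear_matrix_mult_right])

lemma C_seq_sandwich: "transpose L ** C_seq s ** E = transpose (adjusted s L) ** adjusted s E"
proof -
  have "transpose (adjusted s L) ** adjusted s E =
     transpose L ** transpose (X_mat s) ** (Q_mat ** Q_mat) ** X_mat s ** E"
    by (simp add: adjusted_def matrix_transpose_mul transpose_Q_mat matrix_mul_assoc)
  then show ?thesis by (simp add: Q_mat_idem C_seq_def matrix_mul_assoc)
qed

lemma C_xi_sandwich:
  "transpose L ** C_xi n d ** E =
    (\<Sum>s\<in>UNIV. (real n * d s) *\<^sub>R (transpose (adjusted s L) ** adjusted s E))"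
proof -
  have "transpose L ** C_xi n d ** E =
      (\<Sum>s\<in>UNIV. transpose L ** ((real n * d s) *\<^sub>R C_seq s) ** E)"
    by (simp add: C_xi_def scaleR_sum_right linear_sum[OF linear_matrix_mult_right]
        linear_sum[OF linear_matrix_mult_left])
  also have "\<dots> = (\<Sum>s\<in>UNIV. (real n * d s) *\<^sub>R (transpose L ** C_seq s ** E))"
    by (simp only: linear_scale[OF linear_matrix_mult_right]
        linear_scale[OF linear_matrix_mult_left])
  finally show ?thesis by (simp add: C_seq_sandwich)
qed

text \<open>
  A square root of the quadratic form \<open>L \<mapsto> trace (L' C L)\<close>: stacking the blocks \<open>Q X_s L\<close> with
  weights \<open>sqrt (n d s)\<close> makes this form the squared Euclidean norm of a linear map.
\<close>
definition stacked ::
  "nat \<Rightarrow> (('k::{finite,linorder} \<Rightarrow> 't::finite) \<Rightarrow> real) \<Rightarrow> real^'n^('t \<times> 't option)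
    \<Rightarrow> real^'n^('k::{finite,linorder})^('k \<Rightarrow> 't)" where
  "stacked n d L = (\<chi> s. sqrt (real n * d s) *\<^sub>R adjusted s L)"

lemma linear_stacked: "linear (stacked n d)"
  by (rule linearI)
     (simp_all add: stacked_def vec_eq_iff linear_add[OF linear_adjusted]
        linear_scale[OF linear_adjusted] algebra_simps)

lemma design_nonneg: "design d \<Longrightarrow> 0 \<le> d s"
  by (simp add: design_def)

lemma inner_stacked:
  assumes "design d"
  shows "stacked n d L \<bullet> stacked n d E =
    (\<Sum>s\<in>UNIV. real n * d s * (adjusted s L \<bullet> adjusted s E))"
  unfolding inner_vec_def[of "stacked n d L"]
  by (simp add: stacked_def design_nonneg[OF assms] flip: mult.assoc)

lemma trace_C_xi_sandwich:
  assumes "design d"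
  shows "trace (transpose L ** C_xi n d ** E) = stacked n d L \<bullet> stacked n d E"
  by (simp add: inner_stacked[OF assms] C_xi_sandwich linear_sum[OF linear_trace]
      linear_scale[OF linear_trace] trace_transpose_mult)

lemma C_xi_sandwich_nonneg_definite:
  "design d \<Longrightarrow> nonneg_definite (transpose L ** C_xi n d ** L)"
  unfolding C_xi_sandwich
  by (intro nonneg_definite_sum_scaleR nonneg_definite_gram mult_nonneg_nonneg)
     (simp_all add: design_nonneg)

lemma transpose_C_xi: "transpose (C_xi n d) = C_xi n d"
  by (simp add: C_xi_def C_seq_def linear_sum[OF linear_transpose]
      transpose_scalar matrix_transpose_mul transpose_Q_mat matrix_mul_assoc)

text \<open>
  The direction space of the affine constraint \<open>L' K = I\<close>.
\<close>
abbreviation K_annihilators :: "(real^'t^('t::finite \<times> 't option)) set" where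
  "K_annihilators \<equiv> {D. transpose D ** K_mat = 0}"

lemma subspace_K_annihilators: "subspace K_annihilators"
  by (auto simp: subspace_def linear_add[OF linear_transpose] linear_add[OF linear_matrix_mult_left]
      linear_scale[OF linear_transpose] linear_scale[OF linear_matrix_mult_left]
      linear_0[OF linear_transpose] linear_0[OF linear_matrix_mult_left])

lemma transpose_mult_K_mat_nth: "(transpose L ** K_mat) $ i $ j = L $ (j, Some j) $ i"
proof -
  have "(transpose L ** K_mat) $ i $ j =
      (\<Sum>uv\<in>UNIV. if uv = (j, Some j) then L $ uv $ i else 0)"
    unfolding matrix_matrix_mult_def K_mat_def transpose_def vec_lambda_beta
    by (rule sum.cong) (auto simp: prod_eq_iff)
  then show ?thesis by simp
qed

lemma transpose_mult_K_mat_eq_mat_1_iff: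
  "transpose L ** K_mat = mat 1 \<longleftrightarrow> (\<forall>i j. L $ (j, Some j) $ i = (if i = j then 1 else 0))"
  by (simp add: vec_eq_iff transpose_mult_K_mat_nth mat_def)

lemma transpose_K_mat_K_mat: "transpose K_mat ** K_mat = (mat 1 :: real^'t::finite^'t)"
  unfolding transpose_mult_K_mat_eq_mat_1_iff by (simp add: K_mat_def)

text \<open>
  A minimiser of \<open>trace (L' C L)\<close> under \<open>L' K = I\<close> exists by projection, starting from the
  feasible point \<open>K\<close>.  The space of admissible directions \<open>D\<close> is closed under right multiplication
  by any matrix \<open>F\<close>, so the scalar condition \<open>trace (L' C D F) = 0\<close> for all \<open>F\<close> strengthens to
  \<open>L' C D = 0\<close>.
\<close>

lemma normal_equations_solvable:
  fixes d :: "('k::{finite,linorder} \<Rightarrow> 't::finite) \<Rightarrow> real"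
  assumes "design d"
  obtains L :: "real^'t^('t \<times> 't option)" where "transpose L ** K_mat = mat 1"
    and "\<forall>D\<in>K_annihilators. transpose L ** C_xi n d ** D = 0"
proof -
  let ?C = "C_xi n d"
  obtain L :: "real^'t^('t \<times> 't option)" where L: "L - K_mat \<in> K_annihilators"
    and orth: "\<And>D. D \<in> K_annihilators \<Longrightarrow> stacked n d L \<bullet> stacked n d D = 0"
    using least_squares_exists[OF linear_stacked subspace_K_annihilators] by blast
  have LK: "transpose L ** K_mat = mat 1"
    using L by (simp add: linear_diff[OF linear_transpose] linear_diff[OF linear_matrix_mult_left]
        transpose_K_mat_K_mat)
  have normal: "transpose L ** ?C ** D = 0" if D: "D \<in> K_annihilators" for D
  proof -
    have "transpose (?C ** L) ** D = 0"
    proof (rule transpose_mult_eq_0_if_orthogonal)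
      fix F :: "real^'t^'t"
      have "transpose (D ** F) ** K_mat = transpose F ** (transpose D ** K_mat)"
        by (simp add: matrix_transpose_mul matrix_mul_assoc)
      then have "D ** F \<in> K_annihilators"
        using D by (simp add: linear_0[OF linear_matrix_mult_right])
      then show "trace (transpose (?C ** L) ** (D ** F)) = 0"
        using orth[of "D ** F"] trace_C_xi_sandwich[OF assms, of L n "D ** F"]
        by (simp add: matrix_transpose_mul transpose_C_xi)
    qed
    then show ?thesis by (simp add: matrix_transpose_mul transpose_C_xi)
  qed
  show ?thesis by (rule that[OF LK ballI[OF normal]])
qed

text \<open>
  With \<open>D = L2 - L\<close> for a competitor \<open>L2\<close>, the normal equations kill the cross terms and leave
  \<open>L2' C L2 = L' C L + D' C D\<close>, whose last term is nonnegative definite.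
\<close>

lemma normal_equations_loewner_le:
  fixes d :: "('k::{finite,linorder} \<Rightarrow> 't::finite) \<Rightarrow> real"
    and L L' :: "real^'t^('t \<times> 't option)"
  assumes "design d" and LK: "transpose L ** K_mat = mat 1"
    and normal: "\<forall>D\<in>K_annihilators. transpose L ** C_xi n d ** D = 0"
    and L': "transpose L' ** K_mat = mat 1"
  shows "loewner_le (transpose L ** C_xi n d ** L) (transpose L' ** C_xi n d ** L')"
proof -
  let ?C = "C_xi n d" and ?D = "L' - L"
  have D: "?D \<in> K_annihilators"
    using L' LK by (simp add: linear_diff[OF linear_transpose]
        linear_diff[OF linear_matrix_mult_left])
  have "transpose (transpose L ** ?C ** ?D) = transpose ?D ** ?C ** L"
    by (simp add: matrix_transpose_mul transpose_C_xi matrix_mul_assoc)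
  then have n2: "transpose ?D ** ?C ** L = 0"
    using bspec[OF normal D] by (simp add: linear_0[OF linear_transpose])
  have "transpose L' ** ?C ** L' = transpose (L + ?D) ** ?C ** (L + ?D)" by simp
  also have "\<dots> = transpose L ** ?C ** L + transpose ?D ** ?C ** ?D"
    using bspec[OF normal D] n2
    by (simp only: linear_add[OF linear_transpose] linear_add[OF linear_matrix_mult_left]
        linear_add[OF linear_matrix_mult_right]) simp
  finally show ?thesis
    using C_xi_sandwich_nonneg_definite[OF assms(1), of ?D n] by (simp add: loewner_le_def)
qed

lemma C_phi_eq:
  fixes d :: "('k::{finite,linorder} \<Rightarrow> 't::finite) \<Rightarrow> real"
    and L :: "real^'t^('t \<times> 't option)"
  assumes "design d" and LK: "transpose L ** K_mat = mat 1"
    and normal: "\<forall>D\<in>K_annihilators. transpose L ** C_xi n d ** D = 0"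
  shows "C_phi n d = transpose L ** C_xi n d ** L"
  unfolding C_phi_def
proof (rule loewner_Min_eqI)
  fix N assume "N \<in> {transpose L' ** C_xi n d ** L' | L' :: real^'t^('t \<times> 't option).
    transpose L' ** K_mat = mat 1}"
  then show "loewner_le (transpose L ** C_xi n d ** L) N"
    using normal_equations_loewner_le[OF assms] by blast
qed (use LK in blast)

lemma C_phi_obtain:
  fixes d :: "('k::{finite,linorder} \<Rightarrow> 't::finite) \<Rightarrow> real"
  assumes "design d"
  obtains L :: "real^'t^('t \<times> 't option)"
  where "transpose L ** K_mat = mat 1" and "C_phi n d = transpose L ** C_xi n d ** L"
proof -
  obtain L :: "real^'t^('t \<times> 't option)" where LK: "transpose L ** K_mat = mat 1"
    and normal: "\<forall>D\<in>K_annihilators. transpose L ** C_xi n d ** D = 0"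
    using assms by (rule normal_equations_solvable[where n = n])
  show ?thesis by (rule that[OF LK C_phi_eq[OF assms LK normal]])
qed

lemma C_phi_loewner_le:
  fixes d :: "('k::{finite,linorder} \<Rightarrow> 't::finite) \<Rightarrow> real"
    and L' :: "real^'t^('t \<times> 't option)"
  assumes "design d" and L': "transpose L' ** K_mat = mat 1"
  shows "loewner_le (C_phi n d) (transpose L' ** C_xi n d ** L')"
proof -
  obtain L :: "real^'t^('t \<times> 't option)" where LK: "transpose L ** K_mat = mat 1"
    and normal: "\<forall>D\<in>K_annihilators. transpose L ** C_xi n d ** D = 0"
    using assms(1) by (rule normal_equations_solvable[where n = n])
  show ?thesis
    unfolding C_phi_eq[OF assms(1) LK normal]
    by (rule normal_equations_loewner_le[OF assms(1) LK normal L'])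
qed

text \<open>
  For the row sums, the feasible matrix \<open>E\<close> with \<open>E 1 = 1\<close> is used.  By the normal equations
  \<open>L' C L = L' C E\<close>, and \<open>C 1 = 0\<close> because every row of \<open>X_s\<close> has a single 1 and \<open>Q\<close> annihilates
  the constant vector.
\<close>

lemma C_phi_info:
  fixes d :: "('k::{finite,linorder} \<Rightarrow> 't::finite) \<Rightarrow> real"
  assumes "design d"
  shows "C_phi n d \<in> info_matrices"
proof -
  obtain L :: "real^'t^('t \<times> 't option)" where LK: "transpose L ** K_mat = mat 1"
    and normal: "\<forall>D\<in>K_annihilators. transpose L ** C_xi n d ** D = 0"
    using assms by (rule normal_equations_solvable[where n = n])
  note eq = C_phi_eq[OF assms LK normal]
  define E :: "real^'t^('t \<times> 't option)" where "E = (\<chi> uv w. if fst uv = w then 1 else 0)"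
  have EK: "transpose E ** K_mat = mat 1"
    by (simp add: transpose_mult_K_mat_eq_mat_1_iff E_def)
  then have "L - E \<in> K_annihilators"
    using LK by (simp add: linear_diff[OF linear_transpose] linear_diff[OF linear_matrix_mult_left])
  from bspec[OF normal this] have eqE: "C_phi n d = transpose L ** C_xi n d ** E"
    by (simp add: eq linear_diff[OF linear_matrix_mult_right])
  have "(X_mat s ** E) *v 1 = 1" for s :: "'k \<Rightarrow> 't"
    by (simp add: vec_eq_iff matrix_vector_mult_def X_mat_mult_nth E_def)
  then have ones: "adjusted s E *v 1 = 0" for s :: "'k \<Rightarrow> 't"
    by (simp add: adjusted_def Q_mat_ones flip: matrix_vector_mul_assoc)
  have lin: "linear (\<lambda>M :: real^'t^'t. M *v 1)"
    by (rule linearI) (simp_all add: matrix_vector_mult_add_rdistrib scaleR_matrix_vector_assoc)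
  have "C_phi n d *v 1 = 0"
    by (simp add: eqE C_xi_sandwich linear_sum[OF lin] ones
        flip: scaleR_matrix_vector_assoc matrix_vector_mul_assoc)
  then have rows: "(\<Sum>j\<in>UNIV. C_phi n d $ i $ j) = 0" for i
    by (simp add: vec_eq_iff matrix_vector_mult_def)
  have nnd: "nonneg_definite (C_phi n d)"
    by (simp add: eq C_xi_sandwich_nonneg_definite[OF assms])
  then have "C_phi n d $ i $ j = C_phi n d $ j $ i" for i j
    using arg_cong[where f = "\<lambda>M. M $ j $ i"]
    by (auto simp: nonneg_definite_def transpose_def vec_eq_iff)
  then have "(\<Sum>i\<in>UNIV. C_phi n d $ i $ j) = 0" for j using rows[of j] by simp
  with nnd rows show ?thesis by (simp add: info_matrices_def)
qed

section \<open>Relabelling treatments\<close>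

text \<open>
  The diagonal action of a relabelling \<open>\<sigma>\<close> on the row index \<open>uv\<close> and the column index \<open>w\<close>; the
  fictitious treatment \<open>None\<close> is fixed.
\<close>
definition relabel :: "('t \<Rightarrow> 't) \<Rightarrow> real^'t^('t::finite \<times> 't option) \<Rightarrow> real^'t^('t \<times> 't option)"
  where "relabel \<sigma> L = (\<chi> uv w. L $ map_prod \<sigma> (map_option \<sigma>) uv $ \<sigma> w)"

definition permute_cols :: "('t \<Rightarrow> 't) \<Rightarrow> real^'t::finite^'m \<Rightarrow> real^'t^'m"
  where "permute_cols \<sigma> A = (\<chi> j w. A $ j $ \<sigma> w)"

definition permute :: "('t \<Rightarrow> 't) \<Rightarrow> real^'t::finite^'t \<Rightarrow> real^'t^'t"
  where "permute \<sigma> M = (\<chi> i j. M $ \<sigma> i $ \<sigma> j)"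

lemma linear_relabel: "linear (relabel \<sigma>)"
  by (rule linearI) (simp_all add: relabel_def vec_eq_iff)

lemma linear_permute: "linear (permute \<sigma>)"
  by (rule linearI) (simp_all add: permute_def vec_eq_iff)

lemma relabel_relabel: "relabel \<tau> (relabel \<sigma> L) = relabel (\<sigma> \<circ> \<tau>) L"
  by (simp add: relabel_def vec_eq_iff option.map_comp)

lemma permute_permute: "permute \<tau> (permute \<sigma> M) = permute (\<sigma> \<circ> \<tau>) M"
  by (simp add: permute_def vec_eq_iff)

lemma bij_comp_left:
  assumes "bij \<sigma>"
  shows "bij (\<lambda>s. \<sigma> \<circ> s)"
  by (rule o_bij[of "\<lambda>s. inv \<sigma> \<circ> s"])
     (use assms in \<open>auto simp: fun_eq_iff bij_is_surj surj_f_inv_f bij_is_inj\<close>)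

lemma prev_treatment_comp: "prev_treatment (\<sigma> \<circ> s) j = map_option \<sigma> (prev_treatment s j)"
  by (simp add: prev_treatment_def)

text \<open>
  Row \<open>j\<close> of \<open>X_s L\<close> is the row of \<open>L\<close> at \<open>(s j, prev_treatment s j)\<close>, so relabelling \<open>L\<close>
  amounts to relabelling the sequence, up to a permutation of columns.
\<close>

lemma adjusted_relabel: "adjusted s (relabel \<sigma> L) = permute_cols \<sigma> (adjusted (\<sigma> \<circ> s) L)"
proof -
  have "X_mat s ** relabel \<sigma> L = permute_cols \<sigma> (X_mat (\<sigma> \<circ> s) ** L)"
    by (simp add: vec_eq_iff X_mat_mult_nth permute_cols_def relabel_def prev_treatment_comp)
  then show ?thesis
    by (simp add: adjusted_def permute_cols_def matrix_matrix_mult_def vec_eq_iff)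
qed

lemma inner_permute_cols:
  assumes "bij \<sigma>"
  shows "permute_cols \<sigma> A \<bullet> permute_cols \<sigma> B = A \<bullet> B"
  unfolding inner_vec_def permute_cols_def
  using sum.reindex_bij_betw[OF assms, of "\<lambda>w. A $ j $ w * B $ j $ w" for j] by simp

lemma transpose_permute_cols_mult:
  "transpose (permute_cols \<sigma> A) ** permute_cols \<sigma> B = permute \<sigma> (transpose A ** B)"
  by (simp add: vec_eq_iff permute_cols_def permute_def transpose_def matrix_matrix_mult_def)

lemma trace_permute:
  assumes "bij \<sigma>"
  shows "trace (permute \<sigma> M) = trace M"
  unfolding trace_def permute_def
  using sum.reindex_bij_betw[OF assms, of "\<lambda>i. M $ i $ i"] by simp

lemma nonneg_definite_permute:
  assumes "bij \<sigma>" and "nonneg_definite M"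
  shows "nonneg_definite (permute \<sigma> M)"
proof -
  have "0 \<le> x \<bullet> (permute \<sigma> M *v x)" for x
  proof -
    define y where "y = (\<chi> i. x $ inv \<sigma> i)"
    have yx: "y $ \<sigma> i = x $ i" for i using assms(1) by (simp add: y_def bij_is_inj)
    have "y \<bullet> (M *v y) = (\<Sum>i\<in>UNIV. y $ \<sigma> i * (\<Sum>j\<in>UNIV. M $ \<sigma> i $ j * y $ j))"
      using sum.reindex_bij_betw[OF assms(1), of "\<lambda>i. y $ i * (\<Sum>j\<in>UNIV. M $ i $ j * y $ j)"]
      by (simp add: inner_vec_def matrix_vector_mult_def)
    also have "\<dots> = (\<Sum>i\<in>UNIV. y $ \<sigma> i * (\<Sum>j\<in>UNIV. M $ \<sigma> i $ \<sigma> j * y $ \<sigma> j))"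
      using sum.reindex_bij_betw[OF assms(1), of "\<lambda>j. M $ \<sigma> i $ j * y $ j" for i] by simp
    also have "\<dots> = x \<bullet> (permute \<sigma> M *v x)"
      by (simp add: yx inner_vec_def matrix_vector_mult_def permute_def)
    finally show ?thesis using assms(2) by (metis nonneg_definite_def)
  qed
  moreover have "transpose (permute \<sigma> M) = permute \<sigma> M"
    using assms(2) by (simp add: nonneg_definite_def vec_eq_iff transpose_def permute_def)
  ultimately show ?thesis by (simp add: nonneg_definite_def)
qed

lemma info_matrices_permute:
  assumes "bij \<sigma>" and "M \<in> info_matrices"
  shows "permute \<sigma> M \<in> info_matrices"
proof -
  have "(\<Sum>j\<in>UNIV. M $ \<sigma> i $ \<sigma> j) = 0" "(\<Sum>j\<in>UNIV. M $ \<sigma> j $ \<sigma> i) = 0" for i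
    using sum.reindex_bij_betw[OF assms(1), of "\<lambda>j. M $ \<sigma> i $ j"]
      sum.reindex_bij_betw[OF assms(1), of "\<lambda>j. M $ j $ \<sigma> i"] assms(2)
    by (simp_all add: info_matrices_def)
  then show ?thesis
    using assms nonneg_definite_permute by (auto simp: info_matrices_def permute_def)
qed

lemma symmetric_design_design: "symmetric_design d \<Longrightarrow> design d"
  by (simp add: symmetric_design_def)

lemma norm_stacked_relabel:
  assumes "symmetric_design d" and "bij \<sigma>"
  shows "norm (stacked n d (relabel \<sigma> L)) = norm (stacked n d L)"
proof -
  have "stacked n d (relabel \<sigma> L) \<bullet> stacked n d (relabel \<sigma> L) =
      (\<Sum>s\<in>UNIV. real n * d (\<sigma> \<circ> s) * (adjusted (\<sigma> \<circ> s) L \<bullet> adjusted (\<sigma> \<circ> s) L))"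
    using assms by (simp add: inner_stacked symmetric_design_def adjusted_relabel
        inner_permute_cols)
  also have "\<dots> = stacked n d L \<bullet> stacked n d L"
    using sum.reindex_bij_betw[OF bij_comp_left[OF assms(2)],
        of "\<lambda>s. real n * d s * (adjusted s L \<bullet> adjusted s L)"] assms(1)
    by (simp add: inner_stacked symmetric_design_def)
  finally show ?thesis by (simp add: norm_eq_sqrt_inner)
qed

lemma C_xi_sandwich_relabel:
  assumes "symmetric_design d" and "bij \<sigma>"
  shows "transpose (relabel \<sigma> L) ** C_xi n d ** relabel \<sigma> L =
    permute \<sigma> (transpose L ** C_xi n d ** L)"
proof -
  have "transpose (relabel \<sigma> L) ** C_xi n d ** relabel \<sigma> L =
      (\<Sum>s\<in>UNIV. (real n * d (\<sigma> \<circ> s)) *\<^sub>R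
        permute \<sigma> (transpose (adjusted (\<sigma> \<circ> s) L) ** adjusted (\<sigma> \<circ> s) L))"
    using assms by (simp add: C_xi_sandwich symmetric_design_def adjusted_relabel
        transpose_permute_cols_mult)
  also have "\<dots> = (\<Sum>s\<in>UNIV. (real n * d s) *\<^sub>R
        permute \<sigma> (transpose (adjusted s L) ** adjusted s L))"
    by (rule sum.reindex_bij_betw[OF bij_comp_left[OF assms(2)]])
  finally show ?thesis
    by (simp add: C_xi_sandwich linear_sum[OF linear_permute] linear_scale[OF linear_permute])
qed

lemma transpose_relabel_mult_K_mat:
  assumes "bij \<sigma>" and "transpose L ** K_mat = mat 1"
  shows "transpose (relabel \<sigma> L) ** K_mat = mat 1"
  using assms by (auto simp: transpose_mult_K_mat_eq_mat_1_iff relabel_def bij_is_inj inj_eq)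

text \<open>
  For a symmetric design the set of matrices \<open>L' C L\<close> is closed under simultaneous permutation, so
  its minimum lies below each of its permutations.  The bound for \<open>inv \<sigma>\<close>, permuted by \<open>\<sigma>\<close>, is
  the reverse inequality.
\<close>

lemma permute_C_phi:
  fixes d :: "('k::{finite,linorder} \<Rightarrow> 't::finite) \<Rightarrow> real"
  assumes "symmetric_design d" and "bij \<sigma>"
  shows "permute \<sigma> (C_phi n d) = C_phi n d"
proof -
  let ?M = "C_phi n d"
  obtain L :: "real^'t^('t \<times> 't option)" where LK: "transpose L ** K_mat = mat 1"
    and eq: "?M = transpose L ** C_xi n d ** L"
    by (rule C_phi_obtain[OF symmetric_design_design[OF assms(1)], where n = n])
  have le: "nonneg_definite (permute \<tau> ?M - ?M)" if "bij \<tau>" for \<tau>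
    using C_phi_loewner_le[OF symmetric_design_design[OF assms(1)]
        transpose_relabel_mult_K_mat[OF that LK], where n = n]
      C_xi_sandwich_relabel[OF assms(1) that, of L n] by (simp add: loewner_le_def eq)
  have "permute \<sigma> (permute (inv \<sigma>) ?M - ?M) = ?M - permute \<sigma> ?M"
    using assms(2) by (simp add: linear_diff[OF linear_permute] permute_permute bij_is_inj)
       (simp add: permute_def vec_eq_iff)
  then have "nonneg_definite (?M - permute \<sigma> ?M)"
    using nonneg_definite_permute[OF assms(2) le[OF bij_imp_bij_inv[OF assms(2)]]] by simp
  then show ?thesis using nonneg_definite_antisym[OF le[OF assms(2)]] by simp
qed

definition perms :: "('t \<Rightarrow> 't) set" where "perms = {\<sigma>. bij \<sigma>}"

text \<open>
  The weight stands inside the sum so that averages are literally convex combinations.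
\<close>
definition perm_average :: "(('t \<Rightarrow> 't) \<Rightarrow> 'v) \<Rightarrow> 'v::real_vector" where
  "perm_average f = (\<Sum>\<sigma>\<in>perms. (1 / real (card (perms :: ('t \<Rightarrow> 't) set))) *\<^sub>R f \<sigma>)"

lemma perms_nonempty: "perms \<noteq> {}"
proof -
  have "id \<in> perms" by (simp add: perms_def)
  then show ?thesis by blast
qed

lemma perm_weights_sum:
  "(\<Sum>\<sigma>\<in>(perms :: ('t::finite \<Rightarrow> 't) set). 1 / real (card (perms :: ('t \<Rightarrow> 't) set))) = 1"
  by (simp add: perms_nonempty)

lemma perm_average_comp:
  fixes f :: "('t::finite \<Rightarrow> 't) \<Rightarrow> 'v::real_vector"
  assumes "bij \<tau>"
  shows "perm_average (\<lambda>\<sigma>. f (\<sigma> \<circ> \<tau>)) = perm_average f"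
proof -
  have "bij_betw (\<lambda>\<sigma>. \<sigma> \<circ> \<tau>) perms perms"
    by (rule bij_betwI[where g = "\<lambda>\<sigma>. \<sigma> \<circ> inv \<tau>"])
       (use assms in \<open>auto simp: perms_def fun_eq_iff bij_is_inj bij_is_surj surj_f_inv_f
          bij_imp_bij_inv intro: bij_comp\<close>)
  then show ?thesis
    unfolding perm_average_def
    by (rule sum.reindex_bij_betw)
qed

lemma linear_perm_average:
  assumes "linear g"
  shows "g (perm_average f) = perm_average (\<lambda>\<sigma>. g (f \<sigma>))"
  by (simp add: perm_average_def linear_sum[OF assms] linear_scale[OF assms])

lemma perm_average_const: "perm_average (\<lambda>\<sigma> :: 't::finite \<Rightarrow> 't. c) = c"
  by (simp add: perm_average_def sum_constant_scaleR perms_nonempty)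

lemma perm_average_cong:
  assumes "\<And>\<sigma>. bij \<sigma> \<Longrightarrow> f \<sigma> = g \<sigma>"
  shows "perm_average f = perm_average g"
  using assms by (simp add: perm_average_def perms_def)

lemma norm_perm_average_le:
  fixes f :: "('t::finite \<Rightarrow> 't) \<Rightarrow> 'v::real_normed_vector"
  assumes "\<And>\<sigma>. bij \<sigma> \<Longrightarrow> norm (f \<sigma>) \<le> r"
  shows "norm (perm_average f) \<le> r"
proof -
  have "norm (perm_average f) \<le> perm_average (\<lambda>\<sigma>. norm (f \<sigma>))"
    unfolding perm_average_def by (rule order_trans[OF norm_sum]) simp
  also have "\<dots> \<le> perm_average (\<lambda>\<sigma> :: 't \<Rightarrow> 't. r)"
    unfolding perm_average_def
    by (rule sum_mono) (use assms in \<open>auto simp: perms_def intro!: divide_right_mono\<close>)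
  finally show ?thesis by (simp add: perm_average_const)
qed

section \<open>Invariant matrices\<close>

text \<open>
  The complements of \<open>A\<close> and of its image have equal cardinality, so any bijection between them
  completes \<open>f\<close>.
\<close>

lemma inj_on_extends_to_bij:
  fixes f :: "'t::finite \<Rightarrow> 't"
  assumes "inj_on f A"
  obtains \<sigma> where "bij \<sigma>" and "\<forall>x\<in>A. \<sigma> x = f x"
proof -
  have "card (- A) = card (- f ` A)"
    using card_image[OF assms] by (simp add: Compl_eq_Diff_UNIV card_Diff_subset)
  then obtain g where g: "bij_betw g (- A) (- f ` A)"
    using finite_same_card_bij[of "- A" "- f ` A"] by auto
  let ?\<sigma> = "\<lambda>x. if x \<in> A then f x else g x"
  have "bij_betw ?\<sigma> A (f ` A)"
    using assms by (subst bij_betw_cong[of A _ f]) (auto simp: inj_on_imp_bij_betw)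
  moreover have "bij_betw ?\<sigma> (- A) (- f ` A)"
    using g by (subst bij_betw_cong[of "- A" _ g]) auto
  ultimately have "bij_betw ?\<sigma> (A \<union> - A) (f ` A \<union> - f ` A)"
    by (rule bij_betw_combine) auto
  then show ?thesis using that[of ?\<sigma>] by simp
qed

text \<open>
  The orbits are described by equality patterns.  Matching patterns make the obvious
  assignment \<open>u \<mapsto> u'\<close>, \<open>w \<mapsto> w'\<close>, \<open>v \<mapsto> v'\<close> injective, and it extends to a permutation.
\<close>

lemma orbit_transitive:
  assumes "(u, v, w) \<in> orbit q" and "(u', v', w') \<in> orbit q"
  obtains \<sigma> :: "'t::finite \<Rightarrow> 't"
  where "bij \<sigma>" and "\<sigma> u = u'" and "map_option \<sigma> v = v'" and "\<sigma> w = w'"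
proof -
  let ?f = "\<lambda>x. if x = u then u' else if x = w then w' else the v'"
  have inj: "inj_on ?f ({u, w} \<union> set_option v)" and f: "?f u = u'" "map_option ?f v = v'" "?f w = w'"
    using assms by (auto simp: orbit_def inj_on_def split: if_splits)
  obtain \<sigma> where "bij \<sigma>" and "\<forall>x\<in>{u, w} \<union> set_option v. \<sigma> x = ?f x"
    using inj by (rule inj_on_extends_to_bij)
  then show ?thesis using that[of \<sigma>] f by (cases v) (auto split: if_splits)
qed

lemma orbit_map_iff:
  assumes "bij \<sigma>"
  shows "(\<sigma> u, map_option \<sigma> v, \<sigma> w) \<in> orbit q \<longleftrightarrow> (u, v, w) \<in> orbit q"
  using assms by (cases v) (auto simp: orbit_def bij_is_inj inj_eq split: if_splits)

lemma relabel_L_mat: "bij \<sigma> \<Longrightarrow> relabel \<sigma> (L_mat q) = L_mat q"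
  by (simp add: vec_eq_iff relabel_def L_mat_def orbit_map_iff)

definition L_comb :: "(nat \<Rightarrow> real) \<Rightarrow> real^'t^('t::finite \<times> 't option)" where
  "L_comb \<gamma> = (\<Sum>q=1..6. (\<gamma>(1 := 1)) q *\<^sub>R L_mat q)"

lemma L_comb_nth:
  "L_comb \<gamma> $ (u, v) $ w =
    (if v = Some u then if w = u then 1 else 0
     else if v = None then if w = u then \<gamma> 5 else \<gamma> 6
     else if w = u then \<gamma> 2 else if v = Some w then \<gamma> 3 else \<gamma> 4)"
proof -
  have "{1..6} = {1, 2, 3, 4, 5, 6 :: nat}" by auto
  then show ?thesis
    by (cases v) (auto simp: L_comb_def L_mat_def orbit_def)
qed

text \<open>
  The triples \<open>(u, v, w)\<close> form the orbits 1 to 6 and a seventh one, \<open>{(u, Some u, w). w \<noteq> u}\<close>.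
  The constraint \<open>L' K = I\<close> prescribes the entries on orbit 1 (equal to 1) and on the seventh orbit
  (equal to 0); the entries on the other orbits are the free parameters \<open>\<gamma>\<close>.
\<close>

lemma invariant_imp_L_comb:
  fixes L :: "real^'t^('t::finite \<times> 't option)"
  assumes inv: "\<And>\<sigma>. bij \<sigma> \<Longrightarrow> relabel \<sigma> L = L" and LK: "transpose L ** K_mat = mat 1"
  obtains \<gamma> where "L = L_comb \<gamma>"
proof -
  have "\<exists>c. \<forall>u v w. (u, v, w) \<in> orbit q \<longrightarrow> L $ (u, v) $ w = c" for q
  proof (cases "\<exists>u' v' w'. (u', v', w') \<in> (orbit q :: ('t \<times> 't option \<times> 't) set)")
    case True
    then obtain u' v' w' where o': "(u', v', w') \<in> (orbit q :: ('t \<times> 't option \<times> 't) set)"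
      by blast
    have "L $ (u, v) $ w = L $ (u', v') $ w'" if "(u, v, w) \<in> orbit q" for u v w
    proof -
      obtain \<sigma> where \<sigma>: "bij \<sigma>" "\<sigma> u = u'" "map_option \<sigma> v = v'" "\<sigma> w = w'"
        using orbit_transitive[OF \<open>(u, v, w) \<in> orbit q\<close> o'] by blast
      have "L $ (u, v) $ w = relabel \<sigma> L $ (u, v) $ w" using inv[OF \<sigma>(1)] by simp
      then show ?thesis by (simp add: relabel_def \<sigma>)
    qed
    then show ?thesis by blast
  qed blast
  then obtain \<gamma> where \<gamma>: "\<And>q u v w. (u, v, w) \<in> orbit q \<Longrightarrow> L $ (u, v) $ w = \<gamma> q" by metis
  have "L $ (u, v) $ w = L_comb \<gamma> $ (u, v) $ w" for u v w
  proof (cases "v = Some u")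
    case True
    then show ?thesis
      using LK by (simp add: transpose_mult_K_mat_eq_mat_1_iff L_comb_nth)
  next
    case False
    \<comment> \<open>the number of the orbit of \<open>(u, v, w)\<close>\<close>
    define q :: nat where "q = (if v = None then if w = u then 5 else 6
      else if w = u then 2 else if v = Some w then 3 else 4)"
    have "(u, v, w) \<in> orbit q"
      using False by (cases v) (auto simp: orbit_def q_def)
    then have "L $ (u, v) $ w = \<gamma> q" by (rule \<gamma>)
    with False show ?thesis by (simp add: L_comb_nth q_def)
  qed
  then have "L = L_comb \<gamma>" by (simp add: vec_eq_iff)
  then show ?thesis by (rule that)
qed

text \<open>
  Invariance makes all off-diagonal entries equal to some \<open>c\<close>, and the zero row sums then fix the
  diagonal.  For a single treatment the matrix is zero, and so is \<open>Q_mat\<close>, in accordance with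
  the convention \<open>x / 0 = 0\<close>.
\<close>

lemma invariant_zero_sum_matrix:
  fixes M :: "real^'t::finite^'t"
  assumes inv: "\<And>\<sigma>. bij \<sigma> \<Longrightarrow> permute \<sigma> M = M" and rows: "\<And>i. (\<Sum>j\<in>UNIV. M $ i $ j) = 0"
  shows "M = (trace M / (real CARD('t) - 1)) *\<^sub>R Q_mat"
proof -
  let ?t = "real CARD('t)"
  have "\<exists>c. \<forall>i j. i \<noteq> j \<longrightarrow> M $ i $ j = c"
  proof (cases "\<exists>i' j' :: 't. i' \<noteq> j'")
    case True
    then obtain i' j' :: 't where ne: "i' \<noteq> j'" by blast
    have "M $ i $ j = M $ i' $ j'" if "i \<noteq> j" for i j
    proof -
      have inj: "inj_on (\<lambda>x. if x = i then i' else j') {i, j}"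
        using ne by (auto simp: inj_on_def)
      obtain \<sigma> where \<sigma>: "bij \<sigma>" and "\<forall>x\<in>{i, j}. \<sigma> x = (if x = i then i' else j')"
        using inj by (rule inj_on_extends_to_bij)
      then have "\<sigma> i = i'" "\<sigma> j = j'" using that by auto
      then have "permute \<sigma> M $ i $ j = M $ i' $ j'" by (simp add: permute_def)
      then show ?thesis using inv[OF \<sigma>] by simp
    qed
    then show ?thesis by blast
  qed blast
  then obtain c where c: "\<And>i j. i \<noteq> j \<Longrightarrow> M $ i $ j = c" by blast
  have diag: "M $ i $ i = - (?t - 1) * c" for i
  proof -
    have "0 = M $ i $ i + (\<Sum>j\<in>UNIV - {i}. M $ i $ j)"
      using rows[of i] by (simp add: sum.remove[of UNIV i])
    also have "(\<Sum>j\<in>UNIV - {i}. M $ i $ j) = (\<Sum>j\<in>UNIV - {i}. c)"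
      by (rule sum.cong) (auto intro: c)
    also have "\<dots> = (?t - 1) * c"
      by (simp add: card_Diff_singleton of_nat_diff Suc_leI)
    finally show ?thesis by (simp add: algebra_simps)
  qed
  have tr: "trace M = - ?t * (?t - 1) * c" by (simp add: trace_def diag algebra_simps)
  have "M $ i $ j = (trace M / (?t - 1)) * Q_mat $ i $ j" for i j
  proof (cases "?t = 1")
    case True
    then have "i = j"
      by (metis (full_types) UNIV_I card_1_singletonE of_nat_1_eq_iff singletonD)
    with True show ?thesis by (simp add: diag)
  next
    case False
    then have q: "trace M / (?t - 1) = - ?t * c" by (simp add: tr field_simps)
    show ?thesis
      unfolding q by (cases "i = j") (simp_all add: diag c Q_mat_nth algebra_simps)
  qed
  then show ?thesis by (simp add: vec_eq_iff)
qed

lemma Q_mat_info: "Q_mat \<in> (info_matrices :: (real^'t::finite^'t) set)"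
proof -
  have "nonneg_definite (Q_mat :: real^'t^'t)"
    using nonneg_definite_gram[of "Q_mat :: real^'t^'t"] by (simp add: transpose_Q_mat Q_mat_idem)
  then show ?thesis by (simp add: info_matrices_def Q_mat_nth sum_subtractf)
qed

section \<open>The class criterion as a squared norm\<close>

lemma c_seq_eq: "c_seq s p q = adjusted s (L_mat p) \<bullet> adjusted s (L_mat q)"
  by (simp add: c_seq_def C_seq_sandwich trace_transpose_mult)

lemma c_seq_comp:
  fixes s :: "'k::{finite,linorder} \<Rightarrow> 't::finite" and \<sigma> :: "'t \<Rightarrow> 't"
  assumes "bij \<sigma>"
  shows "c_seq (\<sigma> \<circ> s) p q = c_seq s p q"
  using inner_permute_cols[OF assms, of "adjusted (\<sigma> \<circ> s) (L_mat p)" "adjusted (\<sigma> \<circ> s) (L_mat q)"]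
  by (simp add: c_seq_eq relabel_L_mat[OF assms] flip: adjusted_relabel)

lemma equiv_seq_equiv: "equiv UNIV seq_equiv"
proof (rule equivI)
  show "refl seq_equiv" by (auto simp: refl_on_def seq_equiv_def intro!: exI[of _ id])
  show "sym seq_equiv"
  proof (rule symI)
    fix s s' assume "(s, s') \<in> seq_equiv"
    then obtain \<sigma> where "bij \<sigma>" "s' = \<sigma> \<circ> s" by (auto simp: seq_equiv_def)
    then have "bij (inv \<sigma>)" "s = inv \<sigma> \<circ> s'"
      by (auto simp: bij_imp_bij_inv fun_eq_iff bij_is_inj)
    then show "(s', s) \<in> seq_equiv" by (auto simp: seq_equiv_def)
  qed
  show "trans seq_equiv"
  proof (rule transI)
    fix s s' s'' assume "(s, s') \<in> seq_equiv" "(s', s'') \<in> seq_equiv"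
    then obtain \<sigma> \<tau> where "bij \<sigma>" "bij \<tau>" "s' = \<sigma> \<circ> s" "s'' = \<tau> \<circ> s'"
      by (auto simp: seq_equiv_def)
    then have "bij (\<tau> \<circ> \<sigma>)" "s'' = (\<tau> \<circ> \<sigma>) \<circ> s" by (auto simp: bij_comp comp_assoc)
    then show "(s, s'') \<in> seq_equiv" unfolding seq_equiv_def by blast
  qed
qed (auto simp: seq_equiv_def)

lemma c_class_eq:
  assumes "l \<in> seq_classes" and "s \<in> l"
  shows "c_class l p q = c_seq s p q"
proof -
  have "c_seq s' p q = c_seq s p q" if "s' \<in> l" for s'
  proof -
    have "(s, s') \<in> seq_equiv"
      using assms that quotient_eq_iff[OF equiv_seq_equiv, of l l s s']
      by (simp add: seq_classes_def)
    then show ?thesis by (auto simp: seq_equiv_def c_seq_comp)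
  qed
  then have "(\<lambda>s. c_seq s p q) ` l = (\<lambda>_. c_seq s p q) ` l" by (rule image_cong[OF refl])
  also have "\<dots> = {c_seq s p q}" using assms(2) by (rule image_constant)
  finally show ?thesis by (simp add: c_class_def)
qed

lemma h_class_eq:
  assumes "l \<in> seq_classes" and "s \<in> l"
  shows "h_class l \<gamma> = adjusted s (L_comb \<gamma>) \<bullet> adjusted s (L_comb \<gamma>)"
proof -
  let ?g = "\<gamma>(1 := 1)"
  have "adjusted s (L_comb \<gamma>) \<bullet> adjusted s (L_comb \<gamma>) =
      (\<Sum>p=1..6. ?g p * (adjusted s (L_mat p) \<bullet> (\<Sum>q=1..6. ?g q *\<^sub>R adjusted s (L_mat q))))"
    unfolding L_comb_def
    by (simp only: linear_sum[OF linear_adjusted] linear_scale[OF linear_adjusted]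
        inner_sum_left inner_scaleR_left)
  also have "\<dots> = h_class l \<gamma>"
    unfolding h_class_def
    by (simp only: c_class_eq[OF assms] c_seq_eq inner_sum_right inner_scaleR_right
        sum_distrib_left mult.assoc)
  finally show ?thesis ..
qed

lemma sum_seq_classes:
  fixes f :: "('k::finite \<Rightarrow> 't::finite) \<Rightarrow> real"
  shows "(\<Sum>l\<in>seq_classes. \<Sum>s\<in>l. f s) = (\<Sum>s\<in>UNIV. f s)"
proof -
  have "sum f (\<Union>seq_classes) = (sum \<circ> sum) f seq_classes"
    using quotient_disj[OF equiv_seq_equiv]
    by (intro sum.Union_disjoint) (auto simp: seq_classes_def)
  then show ?thesis
    by (simp add: seq_classes_def Union_quotient[OF equiv_seq_equiv])
qed

lemma class_weights_class_proportion:
  assumes "design d"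
  shows "class_weights (class_proportion d)"
  using assms by (simp add: class_weights_def class_proportion_def sum_seq_classes design_def
      sum_nonneg)

text \<open>
  Grouping the sequences by class turns the maximin objective into \<open>trace (L' C L) / n\<close> at
  \<open>L = L_comb \<gamma>\<close>, a quantity that bounds the trace of the information matrix from above.
\<close>

lemma class_criterion_eq:
  assumes "design d"
  shows "real n * (\<Sum>l\<in>seq_classes. class_proportion d l * h_class l \<gamma>) =
    (norm (stacked n d (L_comb \<gamma>)))\<^sup>2"
proof -
  have "(\<Sum>l\<in>seq_classes. class_proportion d l * h_class l \<gamma>) =
      (\<Sum>l\<in>seq_classes. \<Sum>s\<in>l. d s * (adjusted s (L_comb \<gamma>) \<bullet> adjusted s (L_comb \<gamma>)))"
    by (simp add: class_proportion_def sum_distrib_right h_class_eq)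
  then show ?thesis
    by (simp add: sum_seq_classes power2_norm_eq_inner inner_stacked[OF assms] sum_distrib_left
        mult.assoc)
qed

text \<open>
  The matrices \<open>L_comb \<gamma>\<close> form an affine subspace, so the least squares lemma supplies a minimising
  \<open>\<gamma>\<close>; hence the \<open>LEAST\<close> in the definition of \<open>min_h\<close> denotes a minimum that is attained.
\<close>

lemma min_h_class_proportion:
  fixes d :: "('k::{finite,linorder} \<Rightarrow> 't::finite) \<Rightarrow> real"
  assumes "design d" and "n \<ge> 1"
  shows "\<exists>\<gamma>. real n * min_h (class_proportion d) = (norm (stacked n d (L_comb \<gamma>)))\<^sup>2"
    and "real n * min_h (class_proportion d) \<le> (norm (stacked n d (L_comb \<gamma>)))\<^sup>2"
proof -
  let ?f = "\<lambda>\<gamma>. \<Sum>l\<in>seq_classes. class_proportion d l * h_class l \<gamma>"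
  \<comment> \<open>the direction part of \<open>L_comb\<close>, without the fixed summand \<open>L_mat 1\<close>\<close>
  define H :: "(nat \<Rightarrow> real) \<Rightarrow> real^'t^('t \<times> 't option)"
    where "H = (\<lambda>\<gamma>. \<Sum>q=2..6. \<gamma> q *\<^sub>R L_mat q)"
  have H_add: "H \<gamma> + H \<delta> = H (\<lambda>q. \<gamma> q + \<delta> q)" for \<gamma> \<delta>
    by (simp add: H_def scaleR_add_left sum.distrib)
  have H_scale: "c *\<^sub>R H \<gamma> = H (\<lambda>q. c * \<gamma> q)" for c \<gamma>
    by (simp add: H_def scaleR_sum_right)
  have H_0: "0 = H (\<lambda>q. 0)" by (simp add: H_def)
  have sub: "subspace (range H)"
    unfolding subspace_def using H_0 by (auto simp: H_add H_scale)
  have comb: "L_comb \<gamma> = L_mat 1 + H \<gamma>" for \<gamma>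
  proof -
    have "{1..6} = insert 1 {2..6 :: nat}" by auto
    then show ?thesis by (simp add: L_comb_def H_def)
  qed
  obtain z where z: "z - L_mat 1 \<in> range H"
    and orth: "\<And>y. y \<in> range H \<Longrightarrow> stacked n d z \<bullet> stacked n d y = 0"
    using least_squares_exists[OF linear_stacked sub] by blast
  then obtain \<gamma>0 where "z - L_mat 1 = H \<gamma>0" by blast
  then have z_eq: "z = L_comb \<gamma>0" by (simp add: comb algebra_simps)
  have min: "norm (stacked n d (L_comb \<gamma>0)) \<le> norm (stacked n d (L_comb \<gamma>))" for \<gamma>
  proof (rule norm_least_squares_le[OF linear_stacked])
    show "L_comb \<gamma> - L_comb \<gamma>0 \<in> range H"
      using sub by (auto simp: comb intro!: subspace_diff)
  qed (use orth z_eq in auto)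
  have min_f: "?f \<gamma>0 \<le> ?f \<gamma>" for \<gamma>
  proof -
    have "real n * ?f \<gamma>0 \<le> real n * ?f \<gamma>"
      unfolding class_criterion_eq[OF assms(1)] using min by (simp add: power_mono)
    then show ?thesis using assms(2) by simp
  qed
  \<comment> \<open>\<open>min_h\<close> ranges over functions on \<open>{2..6}\<close>; values of \<open>\<gamma>0\<close> elsewhere do not affect the objective\<close>
  have "?f (restrict \<gamma>0 {2..6}) = ?f \<gamma>0"
    unfolding h_class_def by (intro sum.cong arg_cong2[where f = "(*)"] refl) auto
  moreover have "?f (restrict \<gamma>0 {2..6}) \<in> ?f ` ({2..6} \<rightarrow>\<^sub>E UNIV)"
    by (intro imageI) (auto simp: PiE_def extensional_def)
  ultimately have mem: "?f \<gamma>0 \<in> ?f ` ({2..6} \<rightarrow>\<^sub>E UNIV)" by (simp only:)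
  have eq: "min_h (class_proportion d) = ?f \<gamma>0"
    unfolding min_h_def by (rule Least_equality) (use mem min_f in auto)
  show "\<exists>\<gamma>. real n * min_h (class_proportion d) = (norm (stacked n d (L_comb \<gamma>)))\<^sup>2"
    unfolding eq class_criterion_eq[OF assms(1)] by blast
  show "real n * min_h (class_proportion d) \<le> (norm (stacked n d (L_comb \<gamma>)))\<^sup>2"
    unfolding eq class_criterion_eq[OF assms(1)] using min by (simp add: power_mono)
qed

section \<open>Optimality\<close>

lemma trace_C_phi_le:
  fixes d :: "('k::{finite,linorder} \<Rightarrow> 't::finite) \<Rightarrow> real"
  assumes "design d" and "n \<ge> 1"
  shows "trace (C_phi n d) \<le> real n * min_h (class_proportion d)"
proof -
  obtain \<gamma> where \<gamma>: "real n * min_h (class_proportion d) = (norm (stacked n d (L_comb \<gamma>)))\<^sup>2"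
    using min_h_class_proportion(1)[OF assms] by blast
  have "transpose (L_comb \<gamma>) ** K_mat = (mat 1 :: real^'t^'t)"
    by (auto simp: transpose_mult_K_mat_eq_mat_1_iff L_comb_nth)
  then have "loewner_le (C_phi n d) (transpose (L_comb \<gamma>) ** C_xi n d ** L_comb \<gamma>)"
    by (rule C_phi_loewner_le[OF assms(1)])
  then have "0 \<le> trace (transpose (L_comb \<gamma>) ** C_xi n d ** L_comb \<gamma> - C_phi n d)"
    unfolding loewner_le_def by (rule nonneg_definite_trace)
  then show ?thesis
    by (simp add: trace_sub trace_C_xi_sandwich[OF assms(1)] \<gamma> power2_norm_eq_inner)
qed

lemma trace_C_phi_ge:
  fixes d :: "('k::{finite,linorder} \<Rightarrow> 't::finite) \<Rightarrow> real"
  assumes "symmetric_design d" and "n \<ge> 1"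
  shows "real n * min_h (class_proportion d) \<le> trace (C_phi n d)"
proof -
  note des = symmetric_design_design[OF assms(1)]
  obtain L :: "real^'t^('t \<times> 't option)" where LK: "transpose L ** K_mat = mat 1"
    and eq: "C_phi n d = transpose L ** C_xi n d ** L"
    by (rule C_phi_obtain[OF des, where n = n])
  define A where "A = perm_average (\<lambda>\<sigma>. relabel \<sigma> L)"
  have inv: "relabel \<tau> A = A" if "bij \<tau>" for \<tau>
    using perm_average_comp[OF that, of "\<lambda>\<sigma>. relabel \<sigma> L"]
    by (simp add: A_def linear_perm_average[OF linear_relabel] relabel_relabel)
  have lin: "linear (\<lambda>L :: real^'t^('t \<times> 't option). transpose L ** K_mat)"
    using linear_compose[OF linear_transpose linear_matrix_mult_left] by (simp add: comp_def)
  have "transpose A ** K_mat = perm_average (\<lambda>\<sigma> :: 't \<Rightarrow> 't. mat 1)"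
    unfolding A_def linear_perm_average[OF lin]
    by (rule perm_average_cong) (rule transpose_relabel_mult_K_mat[OF _ LK])
  then have "transpose A ** K_mat = mat 1" by (simp add: perm_average_const)
  then obtain \<gamma> where \<gamma>: "A = L_comb \<gamma>" using invariant_imp_L_comb[OF inv] by blast
  have "norm (stacked n d A) \<le> norm (stacked n d L)"
    unfolding A_def linear_perm_average[OF linear_stacked]
    by (rule norm_perm_average_le) (simp add: norm_stacked_relabel[OF assms(1)])
  then have "(norm (stacked n d A))\<^sup>2 \<le> (norm (stacked n d L))\<^sup>2" by simp
  also have "\<dots> = trace (C_phi n d)"
    by (simp add: eq trace_C_xi_sandwich[OF des] power2_norm_eq_inner)
  finally show ?thesis using min_h_class_proportion(2)[OF des assms(2), of \<gamma>] \<gamma> by simp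
qed

lemma info_matrices_convex: "convex info_matrices"
proof (rule convexI)
  fix A B :: "real^'t^'t" and a b :: real
  assume AB: "A \<in> info_matrices" "B \<in> info_matrices" and ab: "0 \<le> a" "0 \<le> b"
  have "nonneg_definite (\<Sum>i\<in>{True, False}. (if i then a else b) *\<^sub>R (if i then A else B))"
    by (rule nonneg_definite_sum_scaleR) (use AB ab in \<open>auto simp: info_matrices_def\<close>)
  then show "a *\<^sub>R A + b *\<^sub>R B \<in> info_matrices"
    using AB by (simp add: info_matrices_def sum.distrib flip: sum_distrib_left)
qed

text \<open>
  The sublevel set of \<open>\<Phi>\<close> at the value \<open>\<Phi> M\<close> is convex and contains all permuted copies of \<open>M\<close>,
  so it contains their average.  Arguing with the sublevel set also covers infinite values.
\<close>

lemma kiefer_criterion_perm_average_le: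
  fixes M :: "real^'t::finite^'t"
  assumes "kiefer_criterion \<Phi>" and M: "M \<in> info_matrices"
  shows "perm_average (\<lambda>\<sigma>. permute \<sigma> M) \<in> info_matrices"
    and "\<Phi> (perm_average (\<lambda>\<sigma>. permute \<sigma> M)) \<le> \<Phi> M"
proof -
  let ?S = "{A \<in> info_matrices. \<Phi> A \<le> \<Phi> M}"
  have invP: "\<Phi> (permute \<sigma> M) = \<Phi> M" if "bij \<sigma>" for \<sigma>
    using assms that by (simp add: kiefer_criterion_def permute_def)
  have "convex ?S"
  proof (rule convexI)
    fix A B and a b :: real
    assume A: "A \<in> ?S" and B: "B \<in> ?S" and ab: "0 \<le> a" "0 \<le> b" "a + b = 1"
    have mem: "a *\<^sub>R A + b *\<^sub>R B \<in> info_matrices"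
      using convexD[OF info_matrices_convex] A B ab by blast
    have "\<Phi> (a *\<^sub>R A + b *\<^sub>R B) \<le> ereal a * \<Phi> A + ereal b * \<Phi> B"
      using assms(1) A B ab by (simp add: kiefer_criterion_def)
    also have "\<dots> \<le> ereal a * \<Phi> M + ereal b * \<Phi> M"
      using A B ab by (intro add_mono ereal_mult_left_mono) auto
    also have "\<dots> = \<Phi> M"
      using ab by (simp flip: ereal_left_distrib)
    finally show "a *\<^sub>R A + b *\<^sub>R B \<in> ?S" using mem by simp
  qed
  then have "perm_average (\<lambda>\<sigma>. permute \<sigma> M) \<in> ?S"
    unfolding perm_average_def
    by (rule convex_sum[rotated])
       (use perm_weights_sum[where 't = 't] info_matrices_permute[OF _ M] invP
         in \<open>auto simp: perms_def\<close>)
  then show "perm_average (\<lambda>\<sigma>. permute \<sigma> M) \<in> info_matrices"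
    "\<Phi> (perm_average (\<lambda>\<sigma>. permute \<sigma> M)) \<le> \<Phi> M" by auto
qed

theorem proposition11:
  fixes n :: nat
    and d' :: "('k::{finite,linorder} \<Rightarrow> 't::finite) \<Rightarrow> real"
  assumes "n \<ge> 1"
    and "symmetric_design d'"
    and "maximin_weights (class_proportion d')"
  shows "universally_optimal n {d. design d} d'"
  unfolding universally_optimal_def
proof (intro allI impI ballI)
  fix \<Phi> :: "real^'t^'t \<Rightarrow> ereal" and d :: "('k \<Rightarrow> 't) \<Rightarrow> real"
  assume \<Phi>: "kiefer_criterion \<Phi>" and "d \<in> {d. design d}"
  then have d: "design d" by simp
  note d' = symmetric_design_design[OF assms(2)]
  define A where "A = perm_average (\<lambda>\<sigma>. permute \<sigma> (C_phi n d))"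
  let ?a = "\<lambda>M :: real^'t^'t. trace M / (real CARD('t) - 1)"
  have A: "A \<in> info_matrices" "\<Phi> A \<le> \<Phi> (C_phi n d)"
    unfolding A_def by (rule kiefer_criterion_perm_average_le[OF \<Phi> C_phi_info[OF d]])+
  have "permute \<tau> A = A" if "bij \<tau>" for \<tau>
    using perm_average_comp[OF that, of "\<lambda>\<sigma>. permute \<sigma> (C_phi n d)"]
    by (simp add: A_def linear_perm_average[OF linear_permute] permute_permute)
  then have A_eq: "A = ?a A *\<^sub>R Q_mat"
    by (rule invariant_zero_sum_matrix) (use A in \<open>simp_all add: info_matrices_def\<close>)
  have C_eq: "C_phi n d' = ?a (C_phi n d') *\<^sub>R Q_mat"
    by (rule invariant_zero_sum_matrix)
       (use C_phi_info[OF d', of n] in \<open>simp_all add: info_matrices_def permute_C_phi[OF assms(2)]\<close>)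
  have "trace A = perm_average (\<lambda>\<sigma> :: 't \<Rightarrow> 't. trace (C_phi n d))"
    unfolding A_def linear_perm_average[OF linear_trace]
    by (rule perm_average_cong) (rule trace_permute)
  also have "\<dots> = trace (C_phi n d)" by (rule perm_average_const)
  also have "\<dots> \<le> real n * min_h (class_proportion d)" by (rule trace_C_phi_le[OF d assms(1)])
  also have "\<dots> \<le> real n * min_h (class_proportion d')"
    using assms(3) class_weights_class_proportion[OF d]
    by (simp add: maximin_weights_def mult_left_mono)
  also have "\<dots> \<le> trace (C_phi n d')" by (rule trace_C_phi_ge[OF assms(2,1)])
  finally have "trace A \<le> trace (C_phi n d')" .
  moreover have "0 \<le> trace A" using A by (simp add: info_matrices_def nonneg_definite_trace)
  moreover have "1 \<le> real CARD('t)" by (simp add: Suc_leI)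
  ultimately have "0 \<le> ?a A" "?a A \<le> ?a (C_phi n d')" by (simp_all add: divide_right_mono)
  then have "\<Phi> (?a (C_phi n d') *\<^sub>R Q_mat) \<le> \<Phi> (?a A *\<^sub>R Q_mat)"
    using \<Phi> Q_mat_info[where 't = 't] by (simp add: kiefer_criterion_def)
  then have "\<Phi> (C_phi n d') \<le> \<Phi> A" using A_eq C_eq by metis
  then show "\<Phi> (C_phi n d') \<le> \<Phi> (C_phi n d)" using A(2) by (rule order_trans)
qed

end
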